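(* For any $\mathcal{L}(\rhd)$-formula $A$, the following are equivalent: 1. $\mathbf{IL}^-(\mathbf{P}) \vdash A$. 2. $\mathbf{GL} \otimes \mathbf{K} \vdash \chi(A)$. 3. $(\mathbf{GL} \otimes \mathbf{K}) \oplus [1][1]\bot \vdash \chi(A)$.
   Context: The language $\mathcal{L}(\rhd)$ has countably many propositional variables, the constant $\bot$, connectives $\neg, \land, \lor, \to$, a unary modal operator $\Box$ and a binary modal operator $\rhd$. The logic $\mathbf{IL}^-(\mathbf{P})$ has as axioms: all tautologies in $\mathcal{L}(\rhd)$; $\Box(A \to B) \to (\Box A \to \Box B)$; $\Box(\Box A \to A) \to \Box A$; $\mathbf{J3}$: $(A \rhd C) \land (B \rhd C) \to (A \lor B) \rhd C$; $\mathbf{J6}$: $\Box A \leftrightarrow (\neg A) \rhd \bot$; and the persistence principle $\mathbf{P}$: $A \rhd B \to \Box(A \rhd B)$ (all as schemes). Its inference rules are Modus Ponens, Necessitation ($A / \Box A$), $\mathbf{R1}$: from $A \to B$ infer $C \rhd A \to C \rhd B$, and $\mathbf{R2}$: from $A \to B$ infer $B \rhd C \to A \rhd C$. The language $\mathcal{L}_2$ is that of propositional logic with two unary modal operators $[0]$ and $[1]$; $\langle 1 \rangle := \neg[1]\neg$. The logic $\mathbf{GL} \otimes \mathbf{K}$ in $\mathcal{L}_2$ has as axioms all tautologies in $\mathcal{L}_2$, $[0](A \to B) \to ([0]A \to [0]B)$, $[0]([0]A \to A) \to [0]A$, $[1](A \to B) \to ([1]A \to [1]B)$, and as rules Modus Ponens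 and Necessitation $A/[k]A$ for $k \in \{0,1\}$. $(\mathbf{GL} \otimes \mathbf{K}) \oplus [1][1]\bot$ is obtained by adding $[1][1]\bot$ as an axiom. The translation $\chi$ from $\mathcal{L}(\rhd)$-formulas to $\mathcal{L}_2$-formulas is: $\chi(\bot) = \bot$; $\chi(p) = p$ for propositional variables $p$; $\chi(\neg A) = \neg\chi(A)$; $\chi(A \circ B) = \chi(A) \circ \chi(B)$ for $\circ \in \{\land, \lor, \to\}$; $\chi(\Box A) = [0]\chi(A)$; $\chi(A \rhd B) = [0]\bigl(\chi(A) \to \langle 1 \rangle \chi(B)\bigr)$. *)

theory Defs
  imports Main
begin

datatype fm =
    Var nat
  | Falsum  ("\<^bold>\<bottom>")
  | Neg fm  ("\<^bold>\<not> _" [80] 80)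
  | Conj fm fm  (infixr "\<^bold>\<and>" 75)
  | Disj fm fm  (infixr "\<^bold>\<or>" 70)
  | Imp fm fm  (infixr "\<^bold>\<longrightarrow>" 60)
  | Box fm  ("\<^bold>\<box> _" [80] 80)
  | Rhd fm fm  (infix "\<^bold>\<rhd>" 65)

abbreviation Iff :: "fm \<Rightarrow> fm \<Rightarrow> fm"  (infix "\<^bold>\<longleftrightarrow>" 58) where
  "A \<^bold>\<longleftrightarrow> B \<equiv> (A \<^bold>\<longrightarrow> B) \<^bold>\<and> (B \<^bold>\<longrightarrow> A)"

text \<open>Tautologies of the full modal language are the formulas true under every Boolean valuation
  that treats variables and all formulas with an outermost modality as atoms; the valuation
  argument is only ever consulted at such formulas.\<close>

primrec truth :: "(fm \<Rightarrow> bool) \<Rightarrow> fm \<Rightarrow> bool" where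
  "truth v (Var n) = v (Var n)"
| "truth v \<^bold>\<bottom> = False"
| "truth v (\<^bold>\<not> A) = (\<not> truth v A)"
| "truth v (A \<^bold>\<and> B) = (truth v A \<and> truth v B)"
| "truth v (A \<^bold>\<or> B) = (truth v A \<or> truth v B)"
| "truth v (A \<^bold>\<longrightarrow> B) = (truth v A \<longrightarrow> truth v B)"
| "truth v (\<^bold>\<box> A) = v (\<^bold>\<box> A)"
| "truth v (A \<^bold>\<rhd> B) = v (A \<^bold>\<rhd> B)"

definition tautology :: "fm \<Rightarrow> bool" where
  "tautology A \<longleftrightarrow> (\<forall>v. truth v A)"

inductive ILmP :: "fm \<Rightarrow> bool" where
  Taut: "tautology A \<Longrightarrow> ILmP A"
| K: "ILmP (\<^bold>\<box> (A \<^bold>\<longrightarrow> B) \<^bold>\<longrightarrow> (\<^bold>\<box> A \<^bold>\<longrightarrow> \<^bold>\<box> B))"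
| Loeb: "ILmP (\<^bold>\<box> (\<^bold>\<box> A \<^bold>\<longrightarrow> A) \<^bold>\<longrightarrow> \<^bold>\<box> A)"
| J3: "ILmP ((A \<^bold>\<rhd> C) \<^bold>\<and> (B \<^bold>\<rhd> C) \<^bold>\<longrightarrow> ((A \<^bold>\<or> B) \<^bold>\<rhd> C))"
| J6: "ILmP (\<^bold>\<box> A \<^bold>\<longleftrightarrow> ((\<^bold>\<not> A) \<^bold>\<rhd> \<^bold>\<bottom>))"
| P: "ILmP ((A \<^bold>\<rhd> B) \<^bold>\<longrightarrow> \<^bold>\<box> (A \<^bold>\<rhd> B))"
| MP: "ILmP (A \<^bold>\<longrightarrow> B) \<Longrightarrow> ILmP A \<Longrightarrow> ILmP B"
| Nec: "ILmP A \<Longrightarrow> ILmP (\<^bold>\<box> A)"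
| R1: "ILmP (A \<^bold>\<longrightarrow> B) \<Longrightarrow> ILmP ((C \<^bold>\<rhd> A) \<^bold>\<longrightarrow> (C \<^bold>\<rhd> B))"
| R2: "ILmP (A \<^bold>\<longrightarrow> B) \<Longrightarrow> ILmP ((B \<^bold>\<rhd> C) \<^bold>\<longrightarrow> (A \<^bold>\<rhd> C))"

datatype fm2 =
    Var2 nat
  | Falsum2  ("\<^bold>\<bottom>\<^sub>2")
  | Neg2 fm2  ("\<^bold>\<not>\<^sub>2 _" [80] 80)
  | Conj2 fm2 fm2  (infixr "\<^bold>\<and>\<^sub>2" 75)
  | Disj2 fm2 fm2  (infixr "\<^bold>\<or>\<^sub>2" 70)
  | Imp2 fm2 fm2  (infixr "\<^bold>\<longrightarrow>\<^sub>2" 60)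
  | Box0 fm2  ("\<^bold>[0\<^bold>] _" [80] 80)
  | Box1 fm2  ("\<^bold>[1\<^bold>] _" [80] 80)

abbreviation Dia1 :: "fm2 \<Rightarrow> fm2"  ("\<^bold>\<langle>1\<^bold>\<rangle> _" [80] 80) where
  "\<^bold>\<langle>1\<^bold>\<rangle> A \<equiv> \<^bold>\<not>\<^sub>2 \<^bold>[1\<^bold>] \<^bold>\<not>\<^sub>2 A"

primrec truth2 :: "(fm2 \<Rightarrow> bool) \<Rightarrow> fm2 \<Rightarrow> bool" where
  "truth2 v (Var2 n) = v (Var2 n)"
| "truth2 v \<^bold>\<bottom>\<^sub>2 = False"
| "truth2 v (\<^bold>\<not>\<^sub>2 A) = (\<not> truth2 v A)"
| "truth2 v (A \<^bold>\<and>\<^sub>2 B) = (truth2 v A \<and> truth2 v B)"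
| "truth2 v (A \<^bold>\<or>\<^sub>2 B) = (truth2 v A \<or> truth2 v B)"
| "truth2 v (A \<^bold>\<longrightarrow>\<^sub>2 B) = (truth2 v A \<longrightarrow> truth2 v B)"
| "truth2 v (\<^bold>[0\<^bold>] A) = v (\<^bold>[0\<^bold>] A)"
| "truth2 v (\<^bold>[1\<^bold>] A) = v (\<^bold>[1\<^bold>] A)"

definition tautology2 :: "fm2 \<Rightarrow> bool" where
  "tautology2 A \<longleftrightarrow> (\<forall>v. truth2 v A)"

text \<open>The calculus for GL (x) K extended by the formulas in \<open>X\<close> as further axioms. There is no
  substitution rule, so members of \<open>X\<close> are taken literally and not as schemes; for the closed
  formula used below this makes no difference.\<close>

inductive GLK_plus :: "fm2 set \<Rightarrow> fm2 \<Rightarrow> bool" for X where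
  Extra: "A \<in> X \<Longrightarrow> GLK_plus X A"
| Taut: "tautology2 A \<Longrightarrow> GLK_plus X A"
| K0: "GLK_plus X (\<^bold>[0\<^bold>] (A \<^bold>\<longrightarrow>\<^sub>2 B) \<^bold>\<longrightarrow>\<^sub>2 (\<^bold>[0\<^bold>] A \<^bold>\<longrightarrow>\<^sub>2 \<^bold>[0\<^bold>] B))"
| Loeb0: "GLK_plus X (\<^bold>[0\<^bold>] (\<^bold>[0\<^bold>] A \<^bold>\<longrightarrow>\<^sub>2 A) \<^bold>\<longrightarrow>\<^sub>2 \<^bold>[0\<^bold>] A)"
| K1: "GLK_plus X (\<^bold>[1\<^bold>] (A \<^bold>\<longrightarrow>\<^sub>2 B) \<^bold>\<longrightarrow>\<^sub>2 (\<^bold>[1\<^bold>] A \<^bold>\<longrightarrow>\<^sub>2 \<^bold>[1\<^bold>] B))"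
| MP: "GLK_plus X (A \<^bold>\<longrightarrow>\<^sub>2 B) \<Longrightarrow> GLK_plus X A \<Longrightarrow> GLK_plus X B"
| Nec0: "GLK_plus X A \<Longrightarrow> GLK_plus X (\<^bold>[0\<^bold>] A)"
| Nec1: "GLK_plus X A \<Longrightarrow> GLK_plus X (\<^bold>[1\<^bold>] A)"

definition GLK :: "fm2 \<Rightarrow> bool" where
  "GLK = GLK_plus {}"

definition GLK_11bot :: "fm2 \<Rightarrow> bool" where
  "GLK_11bot = GLK_plus {\<^bold>[1\<^bold>] \<^bold>[1\<^bold>] \<^bold>\<bottom>\<^sub>2}"

primrec chi :: "fm \<Rightarrow> fm2"  ("\<chi>") where
  "\<chi> (Var n) = Var2 n"
| "\<chi> \<^bold>\<bottom> = \<^bold>\<bottom>\<^sub>2"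
| "\<chi> (\<^bold>\<not> A) = \<^bold>\<not>\<^sub>2 \<chi> A"
| "\<chi> (A \<^bold>\<and> B) = \<chi> A \<^bold>\<and>\<^sub>2 \<chi> B"
| "\<chi> (A \<^bold>\<or> B) = \<chi> A \<^bold>\<or>\<^sub>2 \<chi> B"
| "\<chi> (A \<^bold>\<longrightarrow> B) = \<chi> A \<^bold>\<longrightarrow>\<^sub>2 \<chi> B"
| "\<chi> (\<^bold>\<box> A) = \<^bold>[0\<^bold>] \<chi> A"
| "\<chi> (A \<^bold>\<rhd> B) = \<^bold>[0\<^bold>] (\<chi> A \<^bold>\<longrightarrow>\<^sub>2 \<^bold>\<langle>1\<^bold>\<rangle> \<chi> B)"

end

theory Submission
  imports Defs
begin

text \<open>
  That \<open>\<chi>\<close> preserves derivability is an induction on derivations (\<open>chi_preserves_derivability\<close>): the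
  translation of \<open>A \<rhd> B\<close> is a \<open>[0]\<close>-formula, so P becomes the transitivity of \<open>[0]\<close>, J3 becomes
  distribution of \<open>[0]\<close>, and J6 holds because \<open>\<langle>1\<rangle>\<bottom>\<close> is refutable. Since further axioms only add
  theorems, what remains is that \<open>\<chi> A\<close> is not derivable, even with \<open>[1][1]\<bottom>\<close>, when \<open>A\<close> is
  not (\<open>chi_reflects_derivability\<close>). For this a single Kripke model is built, directly for the
  bimodal language, from maximal consistent sets of \<open>IL\<^sup>-(P)\<close>.

  A formula \<open>C \<rhd> D\<close> must mean at a world \<open>S\<close>: every 0-successor that contains \<open>C\<close> has a 1-successor
  that contains \<open>D\<close>. The 1-successors do not depend on \<open>S\<close>, and a 0-successor \<open>T\<close> that witnesses the
  failure of \<open>A \<rhd> B\<close> must not have any 1-successor containing \<open>B\<close>. Therefore a world carries, besides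
  its maximal consistent set, a label: a formula \<open>B\<close> that its 1-successors avoid. As 1-successors
  of a world labelled \<open>B\<close> one can then take all maximal consistent sets without \<open>B\<close>. These come as
  worlds without a label, which are nobody's 0-successors and have no 1-successors, so that
  \<open>[1][1]\<bottom>\<close> is true everywhere. It remains to put enough conditions on the 0-successors of \<open>S\<close>: a
  formula \<open>C \<rhd> D\<close> in \<open>S\<close> persists, and if \<open>C\<close> is in the successor labelled \<open>B\<close>, then some maximal
  consistent set contains \<open>D\<close> and avoids \<open>B\<close>. Boxes need no separate condition, since J6 expresses
  them by \<open>\<rhd>\<close>.

  The successor relation becomes conversely well-founded by demanding that a successor acquire a
  new \<open>\<rhd>\<close>-formula from a finite set. The witness of the failure of \<open>A \<rhd> B\<close> should then contain both
  \<open>A\<close> and \<open>A \<rhd> B\<close>; that such a witness exists (\<open>succ_exists\<close>) is where the axiom of Loeb enters, in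
  the form \<open>(A \<and> (A \<rhd> B)) \<rhd> B \<rightarrow> A \<rhd> B\<close> (\<open>ILmP_rhd_Loeb\<close>), which depends on P.
\<close>

section \<open>Transferring derivations along the translation\<close>

lemma GLK_taut1:
  assumes "GLK_plus X A" "\<And>v. truth2 v A \<Longrightarrow> truth2 v B"
  shows "GLK_plus X B"
  by (rule GLK_plus.MP[OF GLK_plus.Taut assms(1)]) (simp add: tautology2_def assms(2))

lemma GLK_taut2:
  assumes "GLK_plus X A" "GLK_plus X B" "\<And>v. truth2 v A \<Longrightarrow> truth2 v B \<Longrightarrow> truth2 v C"
  shows "GLK_plus X C"
proof -
  have "GLK_plus X (B \<^bold>\<longrightarrow>\<^sub>2 C)" by (rule GLK_taut1[OF assms(1)]) (simp add: assms(3))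
  then show ?thesis using assms(2) by (rule GLK_plus.MP)
qed

lemma GLK_mono0:
  assumes "GLK_plus X (A \<^bold>\<longrightarrow>\<^sub>2 B)"
  shows "GLK_plus X (\<^bold>[0\<^bold>] A \<^bold>\<longrightarrow>\<^sub>2 \<^bold>[0\<^bold>] B)"
  using GLK_plus.K0 GLK_plus.Nec0[OF assms] by (rule GLK_plus.MP)

lemma GLK_mono1:
  assumes "GLK_plus X (A \<^bold>\<longrightarrow>\<^sub>2 B)"
  shows "GLK_plus X (\<^bold>[1\<^bold>] A \<^bold>\<longrightarrow>\<^sub>2 \<^bold>[1\<^bold>] B)"
  using GLK_plus.K1 GLK_plus.Nec1[OF assms] by (rule GLK_plus.MP)

text \<open>The classical derivation of transitivity in GL: the axiom of Loeb is applied to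
  \<open>A \<and> [0]A\<close>, for which its hypothesis already follows from \<open>[0]A\<close>.\<close>

lemma GLK_trans0: "GLK_plus X (\<^bold>[0\<^bold>] A \<^bold>\<longrightarrow>\<^sub>2 \<^bold>[0\<^bold>] \<^bold>[0\<^bold>] A)"
proof -
  let ?B = "A \<^bold>\<and>\<^sub>2 \<^bold>[0\<^bold>] A"
  have "GLK_plus X (?B \<^bold>\<longrightarrow>\<^sub>2 A)"
    by (rule GLK_plus.Taut) (simp add: tautology2_def)
  then have "GLK_plus X (\<^bold>[0\<^bold>] ?B \<^bold>\<longrightarrow>\<^sub>2 \<^bold>[0\<^bold>] A)" by (rule GLK_mono0)
  then have "GLK_plus X (A \<^bold>\<longrightarrow>\<^sub>2 (\<^bold>[0\<^bold>] ?B \<^bold>\<longrightarrow>\<^sub>2 ?B))" by (rule GLK_taut1) simp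
  then have "GLK_plus X (\<^bold>[0\<^bold>] A \<^bold>\<longrightarrow>\<^sub>2 \<^bold>[0\<^bold>] (\<^bold>[0\<^bold>] ?B \<^bold>\<longrightarrow>\<^sub>2 ?B))" by (rule GLK_mono0)
  then have 1: "GLK_plus X (\<^bold>[0\<^bold>] A \<^bold>\<longrightarrow>\<^sub>2 \<^bold>[0\<^bold>] ?B)"
    using GLK_plus.Loeb0[of X ?B] by (rule GLK_taut2) simp
  have "GLK_plus X (?B \<^bold>\<longrightarrow>\<^sub>2 \<^bold>[0\<^bold>] A)"
    by (rule GLK_plus.Taut) (simp add: tautology2_def)
  then have "GLK_plus X (\<^bold>[0\<^bold>] ?B \<^bold>\<longrightarrow>\<^sub>2 \<^bold>[0\<^bold>] \<^bold>[0\<^bold>] A)" by (rule GLK_mono0)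
  with 1 show ?thesis by (rule GLK_taut2) simp
qed

text \<open>Boolean valuations of \<open>\<L>\<^sub>2\<close> pull back along \<open>\<chi>\<close>, since \<open>\<chi>\<close> sends atoms (in the sense of
  \<^const>\<open>truth\<close>) to atoms.\<close>

lemma truth2_chi: "truth2 v (\<chi> A) = truth (\<lambda>F. v (\<chi> F)) A"
  by (induction A) auto

theorem chi_preserves_derivability:
  assumes "ILmP A"
  shows "GLK_plus X (\<chi> A)"
  using assms
proof induction
  case (Taut A)
  then show ?case by (intro GLK_plus.Taut) (simp add: tautology_def tautology2_def truth2_chi)
next
  case (K A B)
  then show ?case by (simp add: GLK_plus.K0)
next
  case (Loeb A)
  then show ?case by (simp add: GLK_plus.Loeb0)
next
  case (J3 A C B)
  let ?a = "\<chi> A \<^bold>\<longrightarrow>\<^sub>2 \<^bold>\<langle>1\<^bold>\<rangle> \<chi> C" and ?b = "\<chi> B \<^bold>\<longrightarrow>\<^sub>2 \<^bold>\<langle>1\<^bold>\<rangle> \<chi> C"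
    and ?c = "(\<chi> A \<^bold>\<or>\<^sub>2 \<chi> B) \<^bold>\<longrightarrow>\<^sub>2 \<^bold>\<langle>1\<^bold>\<rangle> \<chi> C"
  have "GLK_plus X (?a \<^bold>\<longrightarrow>\<^sub>2 ?b \<^bold>\<longrightarrow>\<^sub>2 ?c)"
    by (rule GLK_plus.Taut) (simp add: tautology2_def)
  then have "GLK_plus X (\<^bold>[0\<^bold>] ?a \<^bold>\<longrightarrow>\<^sub>2 \<^bold>[0\<^bold>] (?b \<^bold>\<longrightarrow>\<^sub>2 ?c))" by (rule GLK_mono0)
  then show ?case using GLK_plus.K0[of X ?b ?c] by (rule GLK_taut2) simp
next
  case (J6 A)
  have "GLK_plus X (\<^bold>\<not>\<^sub>2 \<^bold>\<bottom>\<^sub>2)"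
    by (rule GLK_plus.Taut) (simp add: tautology2_def)
  then have n: "GLK_plus X (\<^bold>[1\<^bold>] \<^bold>\<not>\<^sub>2 \<^bold>\<bottom>\<^sub>2)" by (rule GLK_plus.Nec1)
  let ?a = "\<chi> A" and ?b = "\<^bold>\<not>\<^sub>2 \<chi> A \<^bold>\<longrightarrow>\<^sub>2 \<^bold>\<langle>1\<^bold>\<rangle> \<^bold>\<bottom>\<^sub>2"
  have "GLK_plus X (?a \<^bold>\<longrightarrow>\<^sub>2 ?b)" using n by (rule GLK_taut1) simp
  then have 1: "GLK_plus X (\<^bold>[0\<^bold>] ?a \<^bold>\<longrightarrow>\<^sub>2 \<^bold>[0\<^bold>] ?b)" by (rule GLK_mono0)
  have "GLK_plus X (?b \<^bold>\<longrightarrow>\<^sub>2 ?a)" using n by (rule GLK_taut1) auto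
  then have "GLK_plus X (\<^bold>[0\<^bold>] ?b \<^bold>\<longrightarrow>\<^sub>2 \<^bold>[0\<^bold>] ?a)" by (rule GLK_mono0)
  with 1 show ?case by (rule GLK_taut2) simp
next
  case (P A B)
  then show ?case by (simp add: GLK_trans0)
next
  case (MP A B)
  then show ?case by (auto intro: GLK_plus.MP)
next
  case (Nec A)
  then show ?case by (simp add: GLK_plus.Nec0)
next
  case (R1 A B C)
  then have "GLK_plus X (\<chi> A \<^bold>\<longrightarrow>\<^sub>2 \<chi> B)" by simp
  then have "GLK_plus X (\<^bold>\<not>\<^sub>2 \<chi> B \<^bold>\<longrightarrow>\<^sub>2 \<^bold>\<not>\<^sub>2 \<chi> A)" by (rule GLK_taut1) auto
  then have "GLK_plus X (\<^bold>[1\<^bold>] \<^bold>\<not>\<^sub>2 \<chi> B \<^bold>\<longrightarrow>\<^sub>2 \<^bold>[1\<^bold>] \<^bold>\<not>\<^sub>2 \<chi> A)" by (rule GLK_mono1)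
  then have "GLK_plus X ((\<chi> C \<^bold>\<longrightarrow>\<^sub>2 \<^bold>\<langle>1\<^bold>\<rangle> \<chi> A) \<^bold>\<longrightarrow>\<^sub>2 (\<chi> C \<^bold>\<longrightarrow>\<^sub>2 \<^bold>\<langle>1\<^bold>\<rangle> \<chi> B))"
    by (rule GLK_taut1) auto
  then show ?case by (simp add: GLK_mono0)
next
  case (R2 A B C)
  then have "GLK_plus X (\<chi> A \<^bold>\<longrightarrow>\<^sub>2 \<chi> B)" by simp
  then have "GLK_plus X ((\<chi> B \<^bold>\<longrightarrow>\<^sub>2 \<^bold>\<langle>1\<^bold>\<rangle> \<chi> C) \<^bold>\<longrightarrow>\<^sub>2 (\<chi> A \<^bold>\<longrightarrow>\<^sub>2 \<^bold>\<langle>1\<^bold>\<rangle> \<chi> C))"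
    by (rule GLK_taut1) auto
  then show ?case by (simp add: GLK_mono0)
qed

lemma GLK_plus_mono:
  assumes "GLK_plus X A" "X \<subseteq> Y"
  shows "GLK_plus Y A"
  using assms by induction (auto intro: GLK_plus.intros)

section \<open>Kripke semantics of the bimodal logic\<close>

primrec sat :: "('w \<Rightarrow> 'w \<Rightarrow> bool) \<Rightarrow> ('w \<Rightarrow> 'w \<Rightarrow> bool) \<Rightarrow> ('w \<Rightarrow> nat \<Rightarrow> bool) \<Rightarrow> 'w \<Rightarrow> fm2 \<Rightarrow> bool" where
  "sat R0 R1 V w (Var2 n) = V w n"
| "sat R0 R1 V w \<^bold>\<bottom>\<^sub>2 = False"
| "sat R0 R1 V w (\<^bold>\<not>\<^sub>2 A) = (\<not> sat R0 R1 V w A)"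
| "sat R0 R1 V w (A \<^bold>\<and>\<^sub>2 B) = (sat R0 R1 V w A \<and> sat R0 R1 V w B)"
| "sat R0 R1 V w (A \<^bold>\<or>\<^sub>2 B) = (sat R0 R1 V w A \<or> sat R0 R1 V w B)"
| "sat R0 R1 V w (A \<^bold>\<longrightarrow>\<^sub>2 B) = (sat R0 R1 V w A \<longrightarrow> sat R0 R1 V w B)"
| "sat R0 R1 V w (\<^bold>[0\<^bold>] A) = (\<forall>u. R0 w u \<longrightarrow> sat R0 R1 V u A)"
| "sat R0 R1 V w (\<^bold>[1\<^bold>] A) = (\<forall>u. R1 w u \<longrightarrow> sat R0 R1 V u A)"

lemma truth2_sat: "truth2 (sat R0 R1 V w) A = sat R0 R1 V w A"
  by (induction A) auto

text \<open>The only axiom that is not immediate is that of Loeb: by induction along the conversely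
  well-founded relation, \<open>A\<close> holds at every successor of a world satisfying its hypothesis,
  because by transitivity that hypothesis is inherited by successors.\<close>

lemma GLK_plus_sound:
  assumes "GLK_plus X A"
    and trans: "transp R0" and wf: "wfp R0\<inverse>\<inverse>"
    and X: "\<And>B w. B \<in> X \<Longrightarrow> sat R0 R1 V w B"
  shows "sat R0 R1 V w A"
  using assms(1)
proof (induction arbitrary: w)
  case (Taut A)
  then show ?case using truth2_sat[of R0 R1 V w A] by (simp add: tautology2_def)
next
  case (Loeb0 A)
  have "sat R0 R1 V u A" if "\<forall>u. R0 w u \<longrightarrow> (\<forall>v. R0 u v \<longrightarrow> sat R0 R1 V v A) \<longrightarrow> sat R0 R1 V u A"
    "R0 w u" for u
    using wf that(2)
  proof (induction u rule: wfp_induct_rule)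
    case (less u)
    then have "\<forall>v. R0 u v \<longrightarrow> sat R0 R1 V v A" using trans by (meson conversepI transpD)
    then show ?case using that(1) less.prems by blast
  qed
  then show ?case unfolding sat.simps by blast
next
  case (Extra B)
  then show ?case by (rule X)
qed simp_all

section \<open>Derivations and maximal consistent sets\<close>

lemma ILmP_taut1:
  assumes "ILmP A" "\<And>v. truth v A \<Longrightarrow> truth v B"
  shows "ILmP B"
  by (rule ILmP.MP[OF ILmP.Taut assms(1)]) (simp add: tautology_def assms(2))

lemma ILmP_taut2:
  assumes "ILmP A" "ILmP B" "\<And>v. truth v A \<Longrightarrow> truth v B \<Longrightarrow> truth v C"
  shows "ILmP C"
proof -
  have "ILmP (B \<^bold>\<longrightarrow> C)" by (rule ILmP_taut1[OF assms(1)]) (simp add: assms(3))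
  then show ?thesis using assms(2) by (rule ILmP.MP)
qed

definition derives :: "fm set \<Rightarrow> fm \<Rightarrow> bool" where
  "derives S F \<longleftrightarrow> (\<exists>xs. set xs \<subseteq> S \<and> ILmP (foldr Imp xs F))"

definition mcs :: "fm set \<Rightarrow> bool" where
  "mcs S \<longleftrightarrow> \<not> derives S \<^bold>\<bottom> \<and> (\<forall>T. S \<subset> T \<longrightarrow> derives T \<^bold>\<bottom>)"

lemma truth_foldr_Imp: "truth v (foldr Imp xs F) \<longleftrightarrow> ((\<forall>x\<in>set xs. truth v x) \<longrightarrow> truth v F)"
  by (induction xs) auto

lemma Lindenbaum:
  assumes "\<not> derives S \<^bold>\<bottom>"
  obtains T where "mcs T" "S \<subseteq> T"
proof -
  let ?A = "{T. S \<subseteq> T \<and> \<not> derives T \<^bold>\<bottom>}"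
  have "\<exists>M\<in>?A. \<forall>X\<in>?A. M \<subseteq> X \<longrightarrow> X = M"
  proof (rule subset_Zorn_nonempty)
    show "?A \<noteq> {}" using assms by blast
  next
    fix C assume C: "C \<noteq> {}" "subset.chain ?A C"
    then have sub: "C \<subseteq> ?A" by (simp add: subset_chain_def)
    have "\<not> derives (\<Union>C) \<^bold>\<bottom>"
    proof
      assume "derives (\<Union>C) \<^bold>\<bottom>"
      then obtain xs where xs: "set xs \<subseteq> \<Union>C" "ILmP (foldr Imp xs \<^bold>\<bottom>)"
        unfolding derives_def by blast
      obtain T where "T \<in> C" "set xs \<subseteq> T"
        using finite_subset_Union_chain[OF finite_set xs(1) C] by blast
      then show False using xs(2) sub unfolding derives_def by blast
    qed
    then show "\<Union>C \<in> ?A" using C(1) sub by blast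
  qed
  then obtain M where M: "S \<subseteq> M" "\<not> derives M \<^bold>\<bottom>"
    and max: "\<And>X. S \<subseteq> X \<Longrightarrow> \<not> derives X \<^bold>\<bottom> \<Longrightarrow> M \<subseteq> X \<Longrightarrow> X = M"
    by auto
  have "derives T \<^bold>\<bottom>" if "M \<subset> T" for T using max[of T] M(1) that by blast
  then have "mcs M" using M(2) unfolding mcs_def by blast
  then show ?thesis using that M(1) by blast
qed

text \<open>If \<open>F\<close> were missing, adding it would be inconsistent by maximality; replacing the uses of
  \<open>F\<close> in that refutation by its derivation refutes \<open>S\<close> itself.\<close>

lemma mcs_derives:
  assumes S: "mcs S" and F: "derives S F"
  shows "F \<in> S"
proof (rule ccontr)
  assume "F \<notin> S"
  then have "derives (insert F S) \<^bold>\<bottom>" using S unfolding mcs_def by blast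
  then obtain ys where ys: "set ys \<subseteq> insert F S" "ILmP (foldr Imp ys \<^bold>\<bottom>)"
    unfolding derives_def by blast
  obtain xs where xs: "set xs \<subseteq> S" "ILmP (foldr Imp xs F)"
    using F unfolding derives_def by blast
  let ?zs = "xs @ filter (\<lambda>G. G \<noteq> F) ys"
  have "ILmP (foldr Imp ?zs \<^bold>\<bottom>)"
    by (rule ILmP_taut2[OF xs(2) ys(2)]) (auto simp: truth_foldr_Imp)
  moreover have "set ?zs \<subseteq> S" using xs(1) ys(1) by auto
  ultimately show False using S unfolding mcs_def derives_def by blast
qed

lemma mcs_thm: "mcs S \<Longrightarrow> ILmP F \<Longrightarrow> F \<in> S"
  by (rule mcs_derives) (auto simp: derives_def intro!: exI[of _ "[]"])

lemma mcs_mp: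
  assumes "mcs S" "ILmP (A \<^bold>\<longrightarrow> B)" "A \<in> S"
  shows "B \<in> S"
  using assms by (intro mcs_derives) (auto simp: derives_def intro!: exI[of _ "[A]"])

lemma mcs_mp2:
  assumes "mcs S" "ILmP (A \<^bold>\<longrightarrow> B \<^bold>\<longrightarrow> C)" "A \<in> S" "B \<in> S"
  shows "C \<in> S"
  using assms by (intro mcs_derives) (auto simp: derives_def intro!: exI[of _ "[A, B]"])

lemma mcs_Falsum: "mcs S \<Longrightarrow> \<^bold>\<bottom> \<notin> S"
proof
  assume S: "mcs S" "\<^bold>\<bottom> \<in> S"
  have "ILmP (\<^bold>\<bottom> \<^bold>\<longrightarrow> \<^bold>\<bottom>)" by (rule ILmP.Taut) (simp add: tautology_def)
  then have "derives S \<^bold>\<bottom>" using S(2) by (auto simp: derives_def intro!: exI[of _ "[\<^bold>\<bottom>]"])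
  then show False using S(1) by (simp add: mcs_def)
qed

lemma mcs_Neg:
  assumes S: "mcs S"
  shows "\<^bold>\<not> A \<in> S \<longleftrightarrow> A \<notin> S"
proof
  assume n: "\<^bold>\<not> A \<in> S"
  have "ILmP (\<^bold>\<not> A \<^bold>\<longrightarrow> A \<^bold>\<longrightarrow> \<^bold>\<bottom>)" by (rule ILmP.Taut) (simp add: tautology_def)
  then show "A \<notin> S" using mcs_mp2[OF S _ n] mcs_Falsum[OF S] by blast
next
  assume "A \<notin> S"
  then have "derives (insert A S) \<^bold>\<bottom>" using S unfolding mcs_def by blast
  then obtain ys where ys: "set ys \<subseteq> insert A S" "ILmP (foldr Imp ys \<^bold>\<bottom>)"
    unfolding derives_def by blast
  let ?zs = "filter (\<lambda>G. G \<noteq> A) ys"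
  have "ILmP (foldr Imp ?zs (\<^bold>\<not> A))"
    by (rule ILmP_taut1[OF ys(2)]) (auto simp: truth_foldr_Imp)
  moreover have "set ?zs \<subseteq> S" using ys(1) by auto
  ultimately show "\<^bold>\<not> A \<in> S" using mcs_derives[OF S] unfolding derives_def by blast
qed

text \<open>Membership in a maximal consistent set is itself a Boolean valuation, so it commutes with all
  the connectives at once.\<close>

lemma truth_mcs:
  assumes S: "mcs S"
  shows "truth (\<lambda>F. F \<in> S) A \<longleftrightarrow> A \<in> S"
proof (induction A)
  case (Conj A B)
  have t: "ILmP (A \<^bold>\<and> B \<^bold>\<longrightarrow> A)" "ILmP (A \<^bold>\<and> B \<^bold>\<longrightarrow> B)" "ILmP (A \<^bold>\<longrightarrow> B \<^bold>\<longrightarrow> A \<^bold>\<and> B)"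
    by (rule ILmP.Taut, simp add: tautology_def)+
  then show ?case using Conj mcs_mp[OF S t(1)] mcs_mp[OF S t(2)] mcs_mp2[OF S t(3)] by auto
next
  case (Disj A B)
  have t: "ILmP (A \<^bold>\<longrightarrow> A \<^bold>\<or> B)" "ILmP (B \<^bold>\<longrightarrow> A \<^bold>\<or> B)" "ILmP (A \<^bold>\<or> B \<^bold>\<longrightarrow> \<^bold>\<not> A \<^bold>\<longrightarrow> B)"
    by (rule ILmP.Taut, simp add: tautology_def)+
  then show ?case using Disj mcs_mp[OF S t(1)] mcs_mp[OF S t(2)] mcs_mp2[OF S t(3)] mcs_Neg[OF S, of A]
    by auto
next
  case (Imp A B)
  have t: "ILmP (\<^bold>\<not> A \<^bold>\<longrightarrow> A \<^bold>\<longrightarrow> B)" "ILmP (B \<^bold>\<longrightarrow> A \<^bold>\<longrightarrow> B)" "ILmP ((A \<^bold>\<longrightarrow> B) \<^bold>\<longrightarrow> A \<^bold>\<longrightarrow> B)"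
    by (rule ILmP.Taut, simp add: tautology_def)+
  then show ?case using Imp mcs_mp[OF S t(1)] mcs_mp[OF S t(2)] mcs_mp2[OF S t(3)] mcs_Neg[OF S, of A]
    by auto
qed (simp_all add: mcs_Falsum[OF S] mcs_Neg[OF S])

lemma mcs_separates:
  assumes "\<not> ILmP (D \<^bold>\<longrightarrow> B)"
  obtains T where "mcs T" "D \<in> T" "B \<notin> T"
proof -
  have "\<not> derives {D, \<^bold>\<not> B} \<^bold>\<bottom>"
  proof
    assume "derives {D, \<^bold>\<not> B} \<^bold>\<bottom>"
    then obtain xs where xs: "set xs \<subseteq> {D, \<^bold>\<not> B}" "ILmP (foldr Imp xs \<^bold>\<bottom>)"
      unfolding derives_def by blast
    have "ILmP (D \<^bold>\<longrightarrow> B)"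
      by (rule ILmP_taut1[OF xs(2)]) (use xs(1) in \<open>auto simp: truth_foldr_Imp\<close>)
    then show False using assms by blast
  qed
  then obtain T where "mcs T" "{D, \<^bold>\<not> B} \<subseteq> T" by (rule Lindenbaum)
  then show ?thesis using that mcs_Neg by blast
qed

section \<open>Reasoning with \<open>\<rhd>\<close>\<close>

lemma mcs_Box_iff:
  assumes S: "mcs S"
  shows "\<^bold>\<box> A \<in> S \<longleftrightarrow> (\<^bold>\<not> A \<^bold>\<rhd> \<^bold>\<bottom>) \<in> S"
  using truth_mcs[OF S, of "\<^bold>\<box> A \<^bold>\<longleftrightarrow> (\<^bold>\<not> A \<^bold>\<rhd> \<^bold>\<bottom>)"] mcs_thm[OF S ILmP.J6[of A]] by auto

lemma mcs_rhd_mono: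
  assumes S: "mcs S" and "(A \<^bold>\<rhd> B) \<in> S" "ILmP (A' \<^bold>\<longrightarrow> A)" "ILmP (B \<^bold>\<longrightarrow> B')"
  shows "(A' \<^bold>\<rhd> B') \<in> S"
  using assms mcs_mp[OF S] ILmP.R1 ILmP.R2 by blast

lemma ILmP_Falsum_Imp: "ILmP (\<^bold>\<bottom> \<^bold>\<longrightarrow> B)"
  by (rule ILmP.Taut) (simp add: tautology_def)

text \<open>Necessitation for \<open>\<top>\<close> and J6 yield \<open>\<bottom> \<rhd> \<bottom>\<close>.\<close>

lemma mcs_Falsum_rhd:
  assumes S: "mcs S"
  shows "(\<^bold>\<bottom> \<^bold>\<rhd> B) \<in> S"
proof -
  have "ILmP (\<^bold>\<box> \<^bold>\<not> \<^bold>\<bottom>)" by (intro ILmP.Nec ILmP.Taut) (simp add: tautology_def)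
  then have "(\<^bold>\<not> \<^bold>\<not> \<^bold>\<bottom> \<^bold>\<rhd> \<^bold>\<bottom>) \<in> S" using mcs_thm[OF S] mcs_Box_iff[OF S] by blast
  then show ?thesis by (rule mcs_rhd_mono[OF S _ ILmP_Falsum_Imp ILmP_Falsum_Imp])
qed

lemma mcs_rhd_Disj:
  assumes S: "mcs S" and "(A \<^bold>\<rhd> C) \<in> S" "(B \<^bold>\<rhd> C) \<in> S"
  shows "((A \<^bold>\<or> B) \<^bold>\<rhd> C) \<in> S"
proof -
  have "ILmP ((A \<^bold>\<rhd> C) \<^bold>\<longrightarrow> (B \<^bold>\<rhd> C) \<^bold>\<longrightarrow> ((A \<^bold>\<or> B) \<^bold>\<rhd> C))"
    by (rule ILmP_taut1[OF ILmP.J3[of A C B]]) simp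
  then show ?thesis using assms(2,3) by (rule mcs_mp2[OF S])
qed

text \<open>By P an element \<open>C \<rhd> D\<close> of a maximal consistent set is even necessary there, and J6 turns
  this into \<open>\<not>(C \<rhd> D) \<rhd> \<bottom>\<close>.\<close>

lemma mcs_Neg_rhd:
  assumes S: "mcs S" and "(C \<^bold>\<rhd> D) \<in> S"
  shows "(\<^bold>\<not> (C \<^bold>\<rhd> D) \<^bold>\<rhd> B) \<in> S"
proof -
  have "(\<^bold>\<not> (C \<^bold>\<rhd> D) \<^bold>\<rhd> \<^bold>\<bottom>) \<in> S"
    using assms mcs_mp[OF S ILmP.P] mcs_Box_iff[OF S] by blast
  moreover have "ILmP (\<^bold>\<not> (C \<^bold>\<rhd> D) \<^bold>\<longrightarrow> \<^bold>\<not> (C \<^bold>\<rhd> D))"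
    by (rule ILmP.Taut) (simp add: tautology_def)
  ultimately show ?thesis by (rule mcs_rhd_mono[OF S _ _ ILmP_Falsum_Imp])
qed

lemma ILmP_box_mono:
  assumes "ILmP (A \<^bold>\<longrightarrow> B)"
  shows "ILmP (\<^bold>\<box> A \<^bold>\<longrightarrow> \<^bold>\<box> B)"
  using ILmP.K ILmP.Nec[OF assms] by (rule ILmP.MP)

text \<open>The form of the axiom of Loeb for \<open>\<rhd>\<close>. Let \<open>F = (A \<rhd> B)\<close> and \<open>G = (A \<and> F \<rhd> B)\<close>. If \<open>\<box>F\<close>, then
  \<open>\<not>F \<rhd> B\<close> by J6 and R1, and J3 combines this with \<open>G\<close> to \<open>F\<close>; hence \<open>G\<close> implies
  \<open>\<box>F \<rightarrow> F\<close>. As \<open>G\<close> implies \<open>\<box>G\<close> by P, the axiom of Loeb gives \<open>\<box>F\<close>, and so \<open>F\<close>.\<close>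

lemma ILmP_rhd_Loeb: "ILmP ((A \<^bold>\<and> (A \<^bold>\<rhd> B) \<^bold>\<rhd> B) \<^bold>\<longrightarrow> (A \<^bold>\<rhd> B))"
proof -
  let ?F = "A \<^bold>\<rhd> B"
  let ?G = "A \<^bold>\<and> ?F \<^bold>\<rhd> B"
  have 1: "ILmP (\<^bold>\<box> ?F \<^bold>\<longrightarrow> (\<^bold>\<not> ?F \<^bold>\<rhd> B))"
    by (rule ILmP_taut2[OF ILmP.J6[of ?F] ILmP.R1[OF ILmP_Falsum_Imp[of B], of "\<^bold>\<not> ?F"]]) simp
  have "ILmP (A \<^bold>\<longrightarrow> \<^bold>\<not> ?F \<^bold>\<or> (A \<^bold>\<and> ?F))"
    by (rule ILmP.Taut) (simp add: tautology_def)
  then have "ILmP ((\<^bold>\<not> ?F \<^bold>\<or> (A \<^bold>\<and> ?F) \<^bold>\<rhd> B) \<^bold>\<longrightarrow> ?F)" by (rule ILmP.R2)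
  then have "ILmP ((\<^bold>\<not> ?F \<^bold>\<rhd> B) \<^bold>\<longrightarrow> ?G \<^bold>\<longrightarrow> ?F)"
    using ILmP.J3[of "\<^bold>\<not> ?F" B "A \<^bold>\<and> ?F"] by (rule ILmP_taut2) simp
  with 1 have 2: "ILmP (?G \<^bold>\<longrightarrow> (\<^bold>\<box> ?F \<^bold>\<longrightarrow> ?F))" by (rule ILmP_taut2) simp
  from ILmP_box_mono[OF this] ILmP.Loeb[of ?F] have "ILmP (\<^bold>\<box> ?G \<^bold>\<longrightarrow> \<^bold>\<box> ?F)"
    by (rule ILmP_taut2) simp
  with ILmP.P[of "A \<^bold>\<and> ?F" B] have "ILmP (?G \<^bold>\<longrightarrow> \<^bold>\<box> ?F)" by (rule ILmP_taut2) simp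
  with 2 show ?thesis by (rule ILmP_taut2) simp
qed

section \<open>The canonical model\<close>

text \<open>\<open>T\<close> with the label \<open>B\<close> is admissible as a successor of \<open>S\<close>: the set \<open>U\<close> is what will be a
  1-successor of \<open>T\<close> containing \<open>D\<close>.\<close>

definition succ :: "fm set \<Rightarrow> fm \<Rightarrow> fm set \<Rightarrow> bool" where
  "succ S B T \<longleftrightarrow> mcs T \<and>
     (\<forall>C D. (C \<^bold>\<rhd> D) \<in> S \<longrightarrow> (C \<^bold>\<rhd> D) \<in> T \<and> (C \<in> T \<longrightarrow> (\<exists>U. mcs U \<and> D \<in> U \<and> B \<notin> U)))"

text \<open>The successor is any maximal consistent extension of \<open>{A, A \<rhd> B} \<union> {\<not>C | C \<rhd> B \<in> S}\<close>. The
  negated formulas are forced: if \<open>C \<rhd> B \<in> S\<close>, then \<open>C\<close> in the successor would demand a set that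
  both contains and avoids \<open>B\<close>. Conversely, they suffice: by R1 they exclude every \<open>C\<close> with
  \<open>C \<rhd> D \<in> S\<close> and \<open>D \<rightarrow> B\<close> provable, and for the other \<open>D\<close> some maximal consistent set contains
  \<open>D\<close> and avoids \<open>B\<close>; persistence follows because \<open>\<not>(C \<rhd> D)\<close> is among the
  excluded formulas (\<open>mcs_Neg_rhd\<close>). For consistency, the formulas \<open>C\<close> with \<open>C \<rhd> B \<in> S\<close> are closed
  under disjunction by J3, so an inconsistency yields a single such \<open>C\<close> implied by
  \<open>A \<and> (A \<rhd> B)\<close>; then R2 and \<open>ILmP_rhd_Loeb\<close> give \<open>A \<rhd> B \<in> S\<close>.\<close>

lemma succ_exists:
  assumes S: "mcs S" and AB: "(A \<^bold>\<rhd> B) \<notin> S"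
  obtains T where "succ S B T" "A \<in> T" "(A \<^bold>\<rhd> B) \<in> T"
proof -
  let ?X = "{A, A \<^bold>\<rhd> B} \<union> {\<^bold>\<not> C | C. (C \<^bold>\<rhd> B) \<in> S}"
  have *: "\<exists>C. (C \<^bold>\<rhd> B) \<in> S \<and>
      (\<forall>v. truth v A \<longrightarrow> truth v (A \<^bold>\<rhd> B) \<longrightarrow> \<not> truth v C \<longrightarrow> (\<forall>x\<in>set xs. truth v x))"
    if "set xs \<subseteq> ?X" for xs
    using that
  proof (induction xs)
    case Nil
    then show ?case using mcs_Falsum_rhd[OF S] by auto
  next
    case (Cons x xs)
    then obtain C where C: "(C \<^bold>\<rhd> B) \<in> S"
      "\<And>v. truth v A \<Longrightarrow> truth v (A \<^bold>\<rhd> B) \<Longrightarrow> \<not> truth v C \<Longrightarrow> \<forall>x\<in>set xs. truth v x"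
      by auto
    consider "x = A" | "x = (A \<^bold>\<rhd> B)" | C' where "x = \<^bold>\<not> C'" "(C' \<^bold>\<rhd> B) \<in> S"
      using Cons.prems by auto
    then show ?case
    proof cases
      case 3
      then show ?thesis using C mcs_rhd_Disj[OF S C(1) 3(2)]
        by (intro exI[of _ "C \<^bold>\<or> C'"]) auto
    qed (use C in auto)
  qed
  have "\<not> derives ?X \<^bold>\<bottom>"
  proof
    assume "derives ?X \<^bold>\<bottom>"
    then obtain xs where xs: "set xs \<subseteq> ?X" "ILmP (foldr Imp xs \<^bold>\<bottom>)"
      unfolding derives_def by blast
    obtain C where C: "(C \<^bold>\<rhd> B) \<in> S"
      "\<And>v. truth v A \<Longrightarrow> truth v (A \<^bold>\<rhd> B) \<Longrightarrow> \<not> truth v C \<Longrightarrow> \<forall>x\<in>set xs. truth v x"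
      using *[OF xs(1)] by auto
    have "ILmP (A \<^bold>\<and> (A \<^bold>\<rhd> B) \<^bold>\<longrightarrow> C)"
      by (rule ILmP_taut1[OF xs(2)]) (use C(2) in \<open>auto simp: truth_foldr_Imp\<close>)
    then have "((A \<^bold>\<and> (A \<^bold>\<rhd> B)) \<^bold>\<rhd> B) \<in> S" using C(1) ILmP.R2 mcs_mp[OF S] by blast
    then show False using AB mcs_mp[OF S ILmP_rhd_Loeb] by blast
  qed
  then obtain T where T: "mcs T" "?X \<subseteq> T" by (rule Lindenbaum)
  have out: "C \<notin> T" if "(C \<^bold>\<rhd> B) \<in> S" for C
  proof -
    have "\<^bold>\<not> C \<in> T" using that T(2) by blast
    then show ?thesis using mcs_Neg[OF T(1)] by blast
  qed
  have "succ S B T"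
    unfolding succ_def
  proof (intro conjI allI impI)
    fix C D assume CD: "(C \<^bold>\<rhd> D) \<in> S"
    show "(C \<^bold>\<rhd> D) \<in> T"
      using out[OF mcs_Neg_rhd[OF S CD]] mcs_Neg[OF T(1)] by blast
    assume "C \<in> T"
    then have "\<not> ILmP (D \<^bold>\<longrightarrow> B)" using CD out ILmP.R1 mcs_mp[OF S] by blast
    then show "\<exists>U. mcs U \<and> D \<in> U \<and> B \<notin> U" by (meson mcs_separates)
  qed (rule T(1))
  then show ?thesis using that T(2) by blast
qed

text \<open>J6 makes \<open>\<box>A\<close> interchangeable with \<open>\<not>A \<rhd> \<bottom>\<close>, so a box contributes that formula.\<close>

primrec rhds :: "fm \<Rightarrow> fm set" where
  "rhds (Var n) = {}"
| "rhds \<^bold>\<bottom> = {}"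
| "rhds (\<^bold>\<not> A) = rhds A"
| "rhds (A \<^bold>\<and> B) = rhds A \<union> rhds B"
| "rhds (A \<^bold>\<or> B) = rhds A \<union> rhds B"
| "rhds (A \<^bold>\<longrightarrow> B) = rhds A \<union> rhds B"
| "rhds (\<^bold>\<box> A) = insert (\<^bold>\<not> A \<^bold>\<rhd> \<^bold>\<bottom>) (rhds A)"
| "rhds (A \<^bold>\<rhd> B) = insert (A \<^bold>\<rhd> B) (rhds A \<union> rhds B)"

lemma finite_rhds: "finite (rhds A)"
  by (induction A) auto

lemma rhds_are_rhd: "F \<in> rhds A \<Longrightarrow> \<exists>C D. F = (C \<^bold>\<rhd> D)"
  by (induction A) auto

text \<open>The label is \<open>Some B\<close> if 1-successors must avoid \<open>B\<close>, and \<open>None\<close> if there are no 1-successors.\<close>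

type_synonym world = "fm set \<times> fm option"

definition acc0 :: "fm set \<Rightarrow> world \<Rightarrow> world \<Rightarrow> bool" where
  "acc0 \<Phi> w u \<longleftrightarrow> (\<exists>B. snd u = Some B \<and> succ (fst w) B (fst u)) \<and> (\<exists>F\<in>\<Phi>. F \<in> fst u \<and> F \<notin> fst w)"

definition acc1 :: "world \<Rightarrow> world \<Rightarrow> bool" where
  "acc1 w u \<longleftrightarrow> (\<exists>B. snd w = Some B \<and> B \<notin> fst u) \<and> mcs (fst u) \<and> snd u = None"

definition val :: "world \<Rightarrow> nat \<Rightarrow> bool" where
  "val w n \<longleftrightarrow> Var n \<in> fst w"

lemma acc0_trans: "transp (acc0 (rhds A))"
proof (rule transpI)
  fix x y z assume xy: "acc0 (rhds A) x y" and yz: "acc0 (rhds A) y z"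
  obtain F where F: "F \<in> rhds A" "F \<in> fst y" "F \<notin> fst x"
    using xy unfolding acc0_def by blast
  obtain C D where "F = (C \<^bold>\<rhd> D)" using rhds_are_rhd[OF F(1)] by blast
  then have "F \<in> fst z" using F(2) yz unfolding acc0_def succ_def by blast
  moreover have "\<exists>B. snd z = Some B \<and> succ (fst x) B (fst z)"
    using xy yz unfolding acc0_def succ_def by blast
  ultimately show "acc0 (rhds A) x z" using F unfolding acc0_def by blast
qed

text \<open>Along \<^const>\<open>acc0\<close> the members of the finite set \<open>rhds A\<close> that are missing become fewer.\<close>

lemma acc0_wf: "wfp (acc0 (rhds A))\<inverse>\<inverse>"
proof (rule wfp_if_convertible_to_nat)
  fix u w assume "(acc0 (rhds A))\<inverse>\<inverse> u w"
  then have wu: "acc0 (rhds A) w u" by simp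
  have "rhds A - fst u \<subseteq> rhds A - fst w"
    using wu rhds_are_rhd unfolding acc0_def succ_def by blast
  moreover have "rhds A - fst u \<noteq> rhds A - fst w"
    using wu unfolding acc0_def by blast
  ultimately show "card (rhds A - fst u) < card (rhds A - fst w)"
    by (intro psubset_card_mono) (auto simp: finite_rhds)
qed

lemma acc1_acc1: "\<not> (acc1 w u \<and> acc1 u x)"
  by (auto simp: acc1_def)

text \<open>The semantic clause of \<open>\<chi> (C \<rhd> D)\<close>, for membership instead of satisfaction. The failure of
  \<open>C \<rhd> D\<close> is witnessed by a successor labelled \<open>D\<close>; as it contains the missing \<open>C \<rhd> D\<close> itself, it
  meets the condition of growth within \<open>\<Phi>\<close>.\<close>

lemma rhd_truth:
  assumes w: "mcs (fst w)" and rhd: "(C \<^bold>\<rhd> D) \<in> \<Phi>"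
  shows "(C \<^bold>\<rhd> D) \<in> fst w \<longleftrightarrow> (\<forall>u. acc0 \<Phi> w u \<longrightarrow> C \<in> fst u \<longrightarrow> (\<exists>x. acc1 u x \<and> D \<in> fst x))"
proof
  assume CD: "(C \<^bold>\<rhd> D) \<in> fst w"
  show "\<forall>u. acc0 \<Phi> w u \<longrightarrow> C \<in> fst u \<longrightarrow> (\<exists>x. acc1 u x \<and> D \<in> fst x)"
  proof (intro allI impI)
    fix u assume u: "acc0 \<Phi> w u" "C \<in> fst u"
    obtain B where B: "snd u = Some B" "succ (fst w) B (fst u)"
      using u(1) unfolding acc0_def by blast
    obtain U where "mcs U" "D \<in> U" "B \<notin> U" using B(2) CD u(2) unfolding succ_def by blast
    then show "\<exists>x. acc1 u x \<and> D \<in> fst x"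
      using B(1) by (intro exI[of _ "(U, None)"]) (simp add: acc1_def)
  qed
next
  assume *: "\<forall>u. acc0 \<Phi> w u \<longrightarrow> C \<in> fst u \<longrightarrow> (\<exists>x. acc1 u x \<and> D \<in> fst x)"
  show "(C \<^bold>\<rhd> D) \<in> fst w"
  proof (rule ccontr)
    assume n: "(C \<^bold>\<rhd> D) \<notin> fst w"
    then obtain T where T: "succ (fst w) D T" "C \<in> T" "(C \<^bold>\<rhd> D) \<in> T"
      using succ_exists[OF w] by blast
    then have "acc0 \<Phi> w (T, Some D)" using rhd n unfolding acc0_def by auto
    then show False using * T(2) unfolding acc1_def by force
  qed
qed

text \<open>In the case of a box, \<open>rhd_truth\<close> is applied to \<open>\<not>A \<rhd> \<bottom>\<close>: since no world contains \<open>\<bottom>\<close>, its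
  right-hand side says that no successor contains \<open>\<not>A\<close>.\<close>

lemma truth_lemma:
  assumes "mcs (fst w)" "rhds F \<subseteq> \<Phi>"
  shows "sat (acc0 \<Phi>) acc1 val w (\<chi> F) \<longleftrightarrow> F \<in> fst w"
  using assms
proof (induction F arbitrary: w)
  case (Box A)
  have mcs: "mcs (fst u)" if "acc0 \<Phi> w u" for u using that by (auto simp: acc0_def succ_def)
  have "\<^bold>\<box> A \<in> fst w \<longleftrightarrow> (\<forall>u. acc0 \<Phi> w u \<longrightarrow> \<^bold>\<not> A \<in> fst u \<longrightarrow> (\<exists>x. acc1 u x \<and> \<^bold>\<bottom> \<in> fst x))"
    using mcs_Box_iff[OF Box.prems(1)] rhd_truth[OF Box.prems(1)] Box.prems(2) by simp
  also have "\<dots> \<longleftrightarrow> (\<forall>u. acc0 \<Phi> w u \<longrightarrow> A \<in> fst u)"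
    using mcs mcs_Neg mcs_Falsum unfolding acc1_def by blast
  finally show ?case using Box mcs by auto
next
  case (Rhd A B)
  have mcs0: "mcs (fst u)" if "acc0 \<Phi> w u" for u using that by (auto simp: acc0_def succ_def)
  have mcs1: "mcs (fst x)" if "acc1 u x" for u x using that by (auto simp: acc1_def)
  have A: "sat (acc0 \<Phi>) acc1 val u (\<chi> A) \<longleftrightarrow> A \<in> fst u" if "acc0 \<Phi> w u" for u
    using Rhd.IH(1) Rhd.prems(2) mcs0[OF that] by simp
  have B: "sat (acc0 \<Phi>) acc1 val x (\<chi> B) \<longleftrightarrow> B \<in> fst x" if "acc1 u x" for u x
    using Rhd.IH(2) Rhd.prems(2) mcs1[OF that] by simp
  have "(A \<^bold>\<rhd> B) \<in> fst w \<longleftrightarrow>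
      (\<forall>u. acc0 \<Phi> w u \<longrightarrow> A \<in> fst u \<longrightarrow> (\<exists>x. acc1 u x \<and> B \<in> fst x))"
    by (rule rhd_truth[OF Rhd.prems(1)]) (use Rhd.prems(2) in simp)
  also have "\<dots> \<longleftrightarrow> sat (acc0 \<Phi>) acc1 val w (\<chi> (A \<^bold>\<rhd> B))"
    using A B by (simp cong: conj_cong imp_cong)
  finally show ?case by simp
next
  case (Var n)
  then show ?case by (simp add: val_def)
next
  case Falsum
  then show ?case by (simp add: mcs_Falsum)
next
  case (Neg A)
  then show ?case by (simp add: mcs_Neg)
next
  case (Conj A B)
  then show ?case using truth_mcs[of "fst w" A] truth_mcs[of "fst w" B]
      truth_mcs[of "fst w" "A \<^bold>\<and> B"] by simp
next
  case (Disj A B)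
  then show ?case using truth_mcs[of "fst w" A] truth_mcs[of "fst w" B]
      truth_mcs[of "fst w" "A \<^bold>\<or> B"] by simp
next
  case (Imp A B)
  then show ?case using truth_mcs[of "fst w" A] truth_mcs[of "fst w" B]
      truth_mcs[of "fst w" "A \<^bold>\<longrightarrow> B"] by simp
qed

theorem chi_reflects_derivability:
  assumes "GLK_11bot (\<chi> A)"
  shows "ILmP A"
proof (rule ccontr)
  assume n: "\<not> ILmP A"
  have "\<not> ILmP (\<^bold>\<not> \<^bold>\<bottom> \<^bold>\<longrightarrow> A)"
  proof
    assume "ILmP (\<^bold>\<not> \<^bold>\<bottom> \<^bold>\<longrightarrow> A)"
    then have "ILmP A" by (rule ILmP_taut1) simp
    with n show False by blast
  qed
  then obtain S where S: "mcs S" "A \<notin> S" by (rule mcs_separates)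
  have "sat (acc0 (rhds A)) acc1 val (S, None) (\<chi> A)"
    by (rule GLK_plus_sound[OF assms[unfolded GLK_11bot_def] acc0_trans acc0_wf])
      (use acc1_acc1 in auto)
  then show False using S truth_lemma[of "(S, None)" A "rhds A"] by simp
qed

theorem proposition4p13:
  fixes A :: fm
  shows "(ILmP A \<longleftrightarrow> GLK (\<chi> A)) \<and> (GLK (\<chi> A) \<longleftrightarrow> GLK_11bot (\<chi> A))"
proof -
  have "ILmP A \<Longrightarrow> GLK (\<chi> A)"
    unfolding GLK_def by (rule chi_preserves_derivability)
  moreover have "GLK (\<chi> A) \<Longrightarrow> GLK_11bot (\<chi> A)"
    unfolding GLK_def GLK_11bot_def by (erule GLK_plus_mono) simp
  ultimately show ?thesis using chi_reflects_derivability by blast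
qed

end
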